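(* Let $A$ be a graded associative algebra over a commutative ring $\Bbbk$, equipped with a linear operator $d:A_n\to A_{n+1}$ such that $d\circ d=0$ and such that $d$ is a (graded) derivation. Define $$[a,b]_d:=a\,d(b)-(-1)^{(|a|+1)(|b|+1)}b\,d(a).$$ Then $[-,-]_d$ is a Lie bracket of degree $+1$ on $A$, i.e. it satisfies $$[a,b]_d=-(-1)^{(|a|+1)(|b|+1)}[b,a]_d,\qquad [a,[b,c]_d]_d=[[a,b]_d,c]_d+(-1)^{(|a|+1)(|b|+1)}[b,[a,c]_d]_d .$$ Moreover $d$ is a derivation for $[-,-]_d$: $d([a,b]_d)=[da,b]_d+(-1)^{|a|+1}[a,db]_d$. However, $[-,-]_d$ does not in general satisfy the Poisson relation $[a,bc]_d=[a,b]_dc+(-1)^{(|a|+1)|b|}b[a,c]_d$ (i.e. there exist $\Bbbk$ and such $(A,d)$ for which it fails).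
   Context: Here $|a|$ denotes the degree of a homogeneous element $a$; $d$ is a derivation means $d(ab)=(da)b+(-1)^{|a|}a(db)$. *)

theory Defs
  imports "HOL-Algebra.Module"
begin

definition homogeneous_decomposition ::
    "('b, 'm) ring_scheme \<Rightarrow> (int \<Rightarrow> 'b set) \<Rightarrow> 'b \<Rightarrow> (int \<Rightarrow> 'b) \<Rightarrow> bool" where
  "homogeneous_decomposition A gr x f \<longleftrightarrow>
     (\<forall>n. f n \<in> gr n) \<and> finite {n. f n \<noteq> \<zero>\<^bsub>A\<^esub>} \<and>
     x = (\<Oplus>\<^bsub>A\<^esub>n \<in> {n. f n \<noteq> \<zero>\<^bsub>A\<^esub>}. f n)"

text \<open>
  Associative algebras are not assumed to be commutative or unital, so neither the library
  locale for (commutative) algebras nor the one for (unital) rings applies; the field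
  \<open>one\<close> of the record \<open>A\<close> is ignored.
\<close>

locale graded_assoc_algebra = module R A
  for R (structure) and A (structure) +
  fixes gr :: "int \<Rightarrow> _ set"
  assumes mult_closed:
      "\<lbrakk>x \<in> carrier A; y \<in> carrier A\<rbrakk> \<Longrightarrow> x \<otimes>\<^bsub>A\<^esub> y \<in> carrier A"
    and mult_assoc:
      "\<lbrakk>x \<in> carrier A; y \<in> carrier A; z \<in> carrier A\<rbrakk> \<Longrightarrow>
        (x \<otimes>\<^bsub>A\<^esub> y) \<otimes>\<^bsub>A\<^esub> z = x \<otimes>\<^bsub>A\<^esub> (y \<otimes>\<^bsub>A\<^esub> z)"
    and mult_distrib_left:
      "\<lbrakk>x \<in> carrier A; y \<in> carrier A; z \<in> carrier A\<rbrakk> \<Longrightarrow>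
        (x \<oplus>\<^bsub>A\<^esub> y) \<otimes>\<^bsub>A\<^esub> z = x \<otimes>\<^bsub>A\<^esub> z \<oplus>\<^bsub>A\<^esub> y \<otimes>\<^bsub>A\<^esub> z"
    and mult_distrib_right:
      "\<lbrakk>x \<in> carrier A; y \<in> carrier A; z \<in> carrier A\<rbrakk> \<Longrightarrow>
        x \<otimes>\<^bsub>A\<^esub> (y \<oplus>\<^bsub>A\<^esub> z) = x \<otimes>\<^bsub>A\<^esub> y \<oplus>\<^bsub>A\<^esub> x \<otimes>\<^bsub>A\<^esub> z"
    and smult_mult_left:
      "\<lbrakk>r \<in> carrier R; x \<in> carrier A; y \<in> carrier A\<rbrakk> \<Longrightarrow>
        (r \<odot>\<^bsub>A\<^esub> x) \<otimes>\<^bsub>A\<^esub> y = r \<odot>\<^bsub>A\<^esub> (x \<otimes>\<^bsub>A\<^esub> y)"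
    and smult_mult_right:
      "\<lbrakk>r \<in> carrier R; x \<in> carrier A; y \<in> carrier A\<rbrakk> \<Longrightarrow>
        x \<otimes>\<^bsub>A\<^esub> (r \<odot>\<^bsub>A\<^esub> y) = r \<odot>\<^bsub>A\<^esub> (x \<otimes>\<^bsub>A\<^esub> y)"
    and gr_submodule: "submodule (gr n) R A"
    and gr_direct_sum: "x \<in> carrier A \<Longrightarrow> \<exists>!f. homogeneous_decomposition A gr x f"
    and gr_mult: "\<lbrakk>x \<in> gr m; y \<in> gr n\<rbrakk> \<Longrightarrow> x \<otimes>\<^bsub>A\<^esub> y \<in> gr (m + n)"

text \<open>\<open>gsign A k x\<close> is $(-1)^k x$.\<close>

definition gsign :: "('b, 'm) ring_scheme \<Rightarrow> int \<Rightarrow> 'b \<Rightarrow> 'b" where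
  "gsign A k x = (if even k then x else \<ominus>\<^bsub>A\<^esub> x)"

locale dg_assoc_algebra = graded_assoc_algebra R A gr
  for R (structure) and A (structure) and gr +
  fixes d :: "_ \<Rightarrow> _"
  assumes d_closed: "x \<in> carrier A \<Longrightarrow> d x \<in> carrier A"
    and d_add: "\<lbrakk>x \<in> carrier A; y \<in> carrier A\<rbrakk> \<Longrightarrow> d (x \<oplus>\<^bsub>A\<^esub> y) = d x \<oplus>\<^bsub>A\<^esub> d y"
    and d_smult: "\<lbrakk>r \<in> carrier R; x \<in> carrier A\<rbrakk> \<Longrightarrow> d (r \<odot>\<^bsub>A\<^esub> x) = r \<odot>\<^bsub>A\<^esub> d x"
    and d_degree: "x \<in> gr n \<Longrightarrow> d x \<in> gr (n + 1)"
    and d_square: "x \<in> carrier A \<Longrightarrow> d (d x) = \<zero>\<^bsub>A\<^esub>"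
    and d_derivation:
      "\<lbrakk>x \<in> gr m; y \<in> gr n\<rbrakk> \<Longrightarrow>
        d (x \<otimes>\<^bsub>A\<^esub> y) = d x \<otimes>\<^bsub>A\<^esub> y \<oplus>\<^bsub>A\<^esub> gsign A m (x \<otimes>\<^bsub>A\<^esub> d y)"

definition homogeneous_component ::
    "('b, 'm) ring_scheme \<Rightarrow> (int \<Rightarrow> 'b set) \<Rightarrow> 'b \<Rightarrow> int \<Rightarrow> 'b" where
  "homogeneous_component A gr x = (THE f. homogeneous_decomposition A gr x f)"

definition degree_support ::
    "('b, 'm) ring_scheme \<Rightarrow> (int \<Rightarrow> 'b set) \<Rightarrow> 'b \<Rightarrow> int set" where
  "degree_support A gr x = {n. homogeneous_component A gr x n \<noteq> \<zero>\<^bsub>A\<^esub>}"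

text \<open>
  The formula for the bracket involves the degrees of its arguments, so it is read on
  homogeneous elements and extended bilinearly: \<open>d_bracket\<close> sums it over the homogeneous
  components. Lemma \<open>d_bracket_homogeneous\<close> below recovers the formula.
\<close>

definition d_bracket ::
    "('b, 'm) ring_scheme \<Rightarrow> (int \<Rightarrow> 'b set) \<Rightarrow> ('b \<Rightarrow> 'b) \<Rightarrow> 'b \<Rightarrow> 'b \<Rightarrow> 'b" where
  "d_bracket A gr d a b =
     (\<Oplus>\<^bsub>A\<^esub>m \<in> degree_support A gr a. \<Oplus>\<^bsub>A\<^esub>n \<in> degree_support A gr b.
        homogeneous_component A gr a m \<otimes>\<^bsub>A\<^esub> d (homogeneous_component A gr b n)
        \<ominus>\<^bsub>A\<^esub> gsign A ((m + 1) * (n + 1))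
              (homogeneous_component A gr b n \<otimes>\<^bsub>A\<^esub> d (homogeneous_component A gr a m)))"

text \<open>A Lie bracket of degree \<open>+1\<close> on the graded module underlying \<open>A\<close>.\<close>

locale lie_bracket_degree_1 =
  fixes R :: "('a, 'r) ring_scheme" (structure)
    and A :: "('a, 'b, 'm) module_scheme" (structure)
    and gr :: "int \<Rightarrow> 'b set"
    and br :: "'b \<Rightarrow> 'b \<Rightarrow> 'b"
  assumes br_closed: "\<lbrakk>a \<in> carrier A; b \<in> carrier A\<rbrakk> \<Longrightarrow> br a b \<in> carrier A"
    and br_add_left:
      "\<lbrakk>a \<in> carrier A; a' \<in> carrier A; b \<in> carrier A\<rbrakk> \<Longrightarrow>
        br (a \<oplus>\<^bsub>A\<^esub> a') b = br a b \<oplus>\<^bsub>A\<^esub> br a' b"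
    and br_add_right:
      "\<lbrakk>a \<in> carrier A; b \<in> carrier A; b' \<in> carrier A\<rbrakk> \<Longrightarrow>
        br a (b \<oplus>\<^bsub>A\<^esub> b') = br a b \<oplus>\<^bsub>A\<^esub> br a b'"
    and br_smult_left:
      "\<lbrakk>r \<in> carrier R; a \<in> carrier A; b \<in> carrier A\<rbrakk> \<Longrightarrow>
        br (r \<odot>\<^bsub>A\<^esub> a) b = r \<odot>\<^bsub>A\<^esub> br a b"
    and br_smult_right:
      "\<lbrakk>r \<in> carrier R; a \<in> carrier A; b \<in> carrier A\<rbrakk> \<Longrightarrow>
        br a (r \<odot>\<^bsub>A\<^esub> b) = r \<odot>\<^bsub>A\<^esub> br a b"
    and br_degree: "\<lbrakk>a \<in> gr m; b \<in> gr n\<rbrakk> \<Longrightarrow> br a b \<in> gr (m + n + 1)"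
    and br_antisymmetric:
      "\<lbrakk>a \<in> gr m; b \<in> gr n\<rbrakk> \<Longrightarrow>
        br a b = \<ominus>\<^bsub>A\<^esub> gsign A ((m + 1) * (n + 1)) (br b a)"
    and br_jacobi:
      "\<lbrakk>a \<in> gr m; b \<in> gr n; c \<in> gr p\<rbrakk> \<Longrightarrow>
        br a (br b c) =
        br (br a b) c \<oplus>\<^bsub>A\<^esub> gsign A ((m + 1) * (n + 1)) (br b (br a c))"

context graded_assoc_algebra
begin

lemma gr_carrier: "x \<in> gr n \<Longrightarrow> x \<in> carrier A"
  using submoduleE(1)[OF gr_submodule] by blast

lemma gr_zero: "\<zero>\<^bsub>A\<^esub> \<in> gr n"
  using subgroup.one_closed[OF submodule.axioms(1)[OF gr_submodule[of n]]] by simp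

lemma homogeneous_component_homogeneous:
  assumes "x \<in> gr n"
  shows "homogeneous_component A gr x = (\<lambda>k. if k = n then x else \<zero>\<^bsub>A\<^esub>)"
proof -
  let ?f = "\<lambda>k. if k = n then x else \<zero>\<^bsub>A\<^esub>"
  have x: "x \<in> carrier A" using assms by (rule gr_carrier)
  have supp: "{k. ?f k \<noteq> \<zero>\<^bsub>A\<^esub>} = (if x = \<zero>\<^bsub>A\<^esub> then {} else {n})" by auto
  have "homogeneous_decomposition A gr x ?f"
    unfolding homogeneous_decomposition_def supp using assms x by (auto simp: gr_zero)
  then show ?thesis
    unfolding homogeneous_component_def using gr_direct_sum[OF x] by (rule the1_equality[rotated])
qed

end

context dg_assoc_algebra
begin

lemma d_zero: "d \<zero>\<^bsub>A\<^esub> = \<zero>\<^bsub>A\<^esub>"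
  using d_add[of "\<zero>\<^bsub>A\<^esub>" "\<zero>\<^bsub>A\<^esub>"] d_closed[of "\<zero>\<^bsub>A\<^esub>"] by simp

lemma mult_zero_left: "x \<in> carrier A \<Longrightarrow> \<zero>\<^bsub>A\<^esub> \<otimes>\<^bsub>A\<^esub> x = \<zero>\<^bsub>A\<^esub>"
  using mult_distrib_left[of "\<zero>\<^bsub>A\<^esub>" "\<zero>\<^bsub>A\<^esub>" x] mult_closed[of "\<zero>\<^bsub>A\<^esub>" x] by simp

lemma mult_zero_right: "x \<in> carrier A \<Longrightarrow> x \<otimes>\<^bsub>A\<^esub> \<zero>\<^bsub>A\<^esub> = \<zero>\<^bsub>A\<^esub>"
  using mult_distrib_right[of x "\<zero>\<^bsub>A\<^esub>" "\<zero>\<^bsub>A\<^esub>"] mult_closed[of x "\<zero>\<^bsub>A\<^esub>"] by simp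

lemma d_bracket_homogeneous:
  assumes a: "a \<in> gr m" and b: "b \<in> gr n"
  shows "d_bracket A gr d a b =
    a \<otimes>\<^bsub>A\<^esub> d b \<ominus>\<^bsub>A\<^esub> gsign A ((m + 1) * (n + 1)) (b \<otimes>\<^bsub>A\<^esub> d a)"
proof -
  have ca: "a \<in> carrier A" and cb: "b \<in> carrier A" using a b gr_carrier by auto
  have sa: "degree_support A gr a = (if a = \<zero>\<^bsub>A\<^esub> then {} else {m})"
    unfolding degree_support_def homogeneous_component_homogeneous[OF a] by auto
  have sb: "degree_support A gr b = (if b = \<zero>\<^bsub>A\<^esub> then {} else {n})"
    unfolding degree_support_def homogeneous_component_homogeneous[OF b] by auto
  have cl: "a \<otimes>\<^bsub>A\<^esub> d b \<in> carrier A" "b \<otimes>\<^bsub>A\<^esub> d a \<in> carrier A"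
    using ca cb by (auto intro: mult_closed d_closed)
  have g0: "gsign A k \<zero>\<^bsub>A\<^esub> = \<zero>\<^bsub>A\<^esub>" for k unfolding gsign_def by simp
  have z: "a \<otimes>\<^bsub>A\<^esub> d b \<ominus>\<^bsub>A\<^esub> gsign A k (b \<otimes>\<^bsub>A\<^esub> d a) = \<zero>\<^bsub>A\<^esub>"
    if "a = \<zero>\<^bsub>A\<^esub> \<or> b = \<zero>\<^bsub>A\<^esub>" for k
    using that ca cb by (auto simp: d_zero mult_zero_left mult_zero_right d_closed g0 a_minus_def)
  have "gsign A k x \<in> carrier A" if "x \<in> carrier A" for k x
    using that unfolding gsign_def by simp
  then have cl': "a \<otimes>\<^bsub>A\<^esub> d b \<ominus>\<^bsub>A\<^esub> gsign A k (b \<otimes>\<^bsub>A\<^esub> d a) \<in> carrier A" for k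
    using cl by simp
  show ?thesis
    unfolding d_bracket_def sa sb homogeneous_component_homogeneous[OF a]
      homogeneous_component_homogeneous[OF b]
    using cl' z by auto
qed

end

end

(*
  Since d is a square-zero derivation, d [a, b] = da db - (-1)^((|a|+1)(|b|+1)) db da. Hence every
  term of the Jacobi identity is, up to sign, one of the six monomials x dy dz with {x, y, z} =
  {a, b, c}, and their coefficients agree. The Poisson relation fails for d/de on F2[e]/(e^2).
*)
theory Submission
  imports Defs
begin

section \<open>Signs and the graded pieces\<close>

context graded_assoc_algebra
begin

lemma gsign_closed: "x \<in> carrier A \<Longrightarrow> gsign A k x \<in> carrier A"
  by (simp add: gsign_def)

lemma gsign_zero: "gsign A k \<zero>\<^bsub>A\<^esub> = \<zero>\<^bsub>A\<^esub>"
  by (simp add: gsign_def)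

lemma gsign_add:
  "\<lbrakk>x \<in> carrier A; y \<in> carrier A\<rbrakk> \<Longrightarrow> gsign A k (x \<oplus>\<^bsub>A\<^esub> y) = gsign A k x \<oplus>\<^bsub>A\<^esub> gsign A k y"
  by (simp add: gsign_def M.minus_add M.a_comm)

lemma gsign_smult:
  "\<lbrakk>r \<in> carrier R; x \<in> carrier A\<rbrakk> \<Longrightarrow> gsign A k (r \<odot>\<^bsub>A\<^esub> x) = r \<odot>\<^bsub>A\<^esub> gsign A k x"
  by (simp add: gsign_def smult_r_minus)

lemma gsign_gr: "x \<in> gr n \<Longrightarrow> gsign A k x \<in> gr n"
  using submoduleE(3)[OF gr_submodule] by (simp add: gsign_def)

lemma gr_add: "\<lbrakk>x \<in> gr n; y \<in> gr n\<rbrakk> \<Longrightarrow> x \<oplus>\<^bsub>A\<^esub> y \<in> gr n"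
  using submoduleE(5)[OF gr_submodule] .

lemma gr_minus: "\<lbrakk>x \<in> gr n; y \<in> gr n\<rbrakk> \<Longrightarrow> x \<ominus>\<^bsub>A\<^esub> y \<in> gr n"
  using submoduleE(3)[OF gr_submodule] by (simp add: a_minus_def gr_add)

lemma gr_smult: "\<lbrakk>r \<in> carrier R; x \<in> gr n\<rbrakk> \<Longrightarrow> r \<odot>\<^bsub>A\<^esub> x \<in> gr n"
  using submoduleE(4)[OF gr_submodule] .

section \<open>Homogeneous components and their linearity\<close>

lemma homogeneous_decomposition_component:
  assumes "x \<in> carrier A"
  shows "homogeneous_decomposition A gr x (homogeneous_component A gr x)"
  unfolding homogeneous_component_def using theI'[OF gr_direct_sum[OF assms]] .

lemma homogeneous_component_gr:
  "x \<in> carrier A \<Longrightarrow> homogeneous_component A gr x n \<in> gr n"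
  using homogeneous_decomposition_component unfolding homogeneous_decomposition_def by blast

lemma homogeneous_component_closed:
  "x \<in> carrier A \<Longrightarrow> homogeneous_component A gr x n \<in> carrier A"
  using homogeneous_component_gr gr_carrier by blast

lemma finite_degree_support: "x \<in> carrier A \<Longrightarrow> finite (degree_support A gr x)"
  using homogeneous_decomposition_component
  unfolding homogeneous_decomposition_def degree_support_def by blast

lemma homogeneous_component_outside_support:
  "n \<notin> degree_support A gr x \<Longrightarrow> homogeneous_component A gr x n = \<zero>\<^bsub>A\<^esub>"
  by (simp add: degree_support_def)

text \<open>Components outside the support are zero, so they may be added freely. The freedom in
  \<open>S\<close> lets several elements be summed over one common index set.\<close>

lemma sum_homogeneous_components:
  assumes "x \<in> carrier A" "finite S" "degree_support A gr x \<subseteq> S"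
  shows "(\<Oplus>\<^bsub>A\<^esub>n \<in> S. homogeneous_component A gr x n) = x"
proof -
  have "x = (\<Oplus>\<^bsub>A\<^esub>n \<in> degree_support A gr x. homogeneous_component A gr x n)"
    using homogeneous_decomposition_component[OF assms(1)]
    unfolding homogeneous_decomposition_def degree_support_def by blast
  also have "\<dots> = (\<Oplus>\<^bsub>A\<^esub>n \<in> S. homogeneous_component A gr x n)"
    using assms by (intro M.add.finprod_mono_neutral_cong_left)
      (auto simp: homogeneous_component_outside_support homogeneous_component_closed)
  finally show ?thesis by simp
qed

text \<open>This is the uniqueness half of the direct sum decomposition. \<open>S\<close> may exceed
  the support of \<open>f\<close>: in a sum components may cancel, and a scalar may annihilate some
  of them, so the exact support is not known in advance.\<close>

lemma homogeneous_component_eqI: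
  assumes f: "\<And>n. f n \<in> gr n" and S: "finite S" "\<And>n. n \<notin> S \<Longrightarrow> f n = \<zero>\<^bsub>A\<^esub>"
    and x: "x = (\<Oplus>\<^bsub>A\<^esub>n \<in> S. f n)"
  shows "homogeneous_component A gr x = f"
proof -
  have fc: "f n \<in> carrier A" for n using f gr_carrier by blast
  have sub: "{n. f n \<noteq> \<zero>\<^bsub>A\<^esub>} \<subseteq> S" using S by blast
  have "(\<Oplus>\<^bsub>A\<^esub>n \<in> {n. f n \<noteq> \<zero>\<^bsub>A\<^esub>}. f n) = (\<Oplus>\<^bsub>A\<^esub>n \<in> S. f n)"
    using sub S fc by (intro M.add.finprod_mono_neutral_cong_left) auto
  then have "homogeneous_decomposition A gr x f"
    unfolding homogeneous_decomposition_def using f finite_subset[OF sub S(1)] x by simp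
  moreover have "x \<in> carrier A" unfolding x using fc by (simp add: Pi_def)
  ultimately show ?thesis
    unfolding homogeneous_component_def using gr_direct_sum by (intro the1_equality) auto
qed

lemma homogeneous_component_add:
  assumes x: "x \<in> carrier A" and y: "y \<in> carrier A"
  shows "homogeneous_component A gr (x \<oplus>\<^bsub>A\<^esub> y) n =
    homogeneous_component A gr x n \<oplus>\<^bsub>A\<^esub> homogeneous_component A gr y n"
proof -
  let ?S = "degree_support A gr x \<union> degree_support A gr y"
  have S: "finite ?S" using x y by (simp add: finite_degree_support)
  have "homogeneous_component A gr (x \<oplus>\<^bsub>A\<^esub> y) =
    (\<lambda>n. homogeneous_component A gr x n \<oplus>\<^bsub>A\<^esub> homogeneous_component A gr y n)"
  proof (rule homogeneous_component_eqI[OF _ S])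
    show "x \<oplus>\<^bsub>A\<^esub> y = (\<Oplus>\<^bsub>A\<^esub>n \<in> ?S. homogeneous_component A gr x n \<oplus>\<^bsub>A\<^esub> homogeneous_component A gr y n)"
      using x y S by (simp add: M.finsum_addf Pi_def homogeneous_component_closed
          sum_homogeneous_components)
  qed (use x y in \<open>auto simp: homogeneous_component_outside_support
         intro: gr_add homogeneous_component_gr\<close>)
  then show ?thesis by simp
qed

lemma homogeneous_component_smult:
  assumes r: "r \<in> carrier R" and x: "x \<in> carrier A"
  shows "homogeneous_component A gr (r \<odot>\<^bsub>A\<^esub> x) n = r \<odot>\<^bsub>A\<^esub> homogeneous_component A gr x n"
proof -
  let ?S = "degree_support A gr x"
  have S: "finite ?S" using x by (simp add: finite_degree_support)
  have "homogeneous_component A gr (r \<odot>\<^bsub>A\<^esub> x) = (\<lambda>n. r \<odot>\<^bsub>A\<^esub> homogeneous_component A gr x n)"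
  proof (rule homogeneous_component_eqI[OF _ S])
    show "r \<odot>\<^bsub>A\<^esub> x = (\<Oplus>\<^bsub>A\<^esub>n \<in> ?S. r \<odot>\<^bsub>A\<^esub> homogeneous_component A gr x n)"
      using r x S by (simp add: finsum_smult_ldistr[symmetric] Pi_def homogeneous_component_closed
          sum_homogeneous_components)
  qed (use r x in \<open>auto simp: homogeneous_component_outside_support
         intro: gr_smult homogeneous_component_gr\<close>)
  then show ?thesis by simp
qed

end

section \<open>Bilinearity of the bracket on arbitrary elements\<close>

context dg_assoc_algebra
begin

text \<open>Here (-x) y + x y = 0 y = 0, and additive inverses are unique; the two analogous lemmas
  below argue in the same way.\<close>

lemma mult_uminus_left:
  assumes "x \<in> carrier A" "y \<in> carrier A"
  shows "(\<ominus>\<^bsub>A\<^esub> x) \<otimes>\<^bsub>A\<^esub> y = \<ominus>\<^bsub>A\<^esub> (x \<otimes>\<^bsub>A\<^esub> y)"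
  using assms mult_distrib_left[of "\<ominus>\<^bsub>A\<^esub> x" x y]
  by (intro M.minus_equality[symmetric]) (simp_all add: mult_closed M.l_neg mult_zero_left mult_zero_right)

lemma mult_uminus_right:
  assumes "x \<in> carrier A" "y \<in> carrier A"
  shows "x \<otimes>\<^bsub>A\<^esub> (\<ominus>\<^bsub>A\<^esub> y) = \<ominus>\<^bsub>A\<^esub> (x \<otimes>\<^bsub>A\<^esub> y)"
  using assms mult_distrib_right[of x "\<ominus>\<^bsub>A\<^esub> y" y]
  by (intro M.minus_equality[symmetric]) (simp_all add: mult_closed M.l_neg mult_zero_left mult_zero_right)

lemma mult_gsign_left:
  "\<lbrakk>x \<in> carrier A; y \<in> carrier A\<rbrakk> \<Longrightarrow> gsign A k x \<otimes>\<^bsub>A\<^esub> y = gsign A k (x \<otimes>\<^bsub>A\<^esub> y)"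
  by (simp add: gsign_def mult_uminus_left)

lemma mult_gsign_right:
  "\<lbrakk>x \<in> carrier A; y \<in> carrier A\<rbrakk> \<Longrightarrow> x \<otimes>\<^bsub>A\<^esub> gsign A k y = gsign A k (x \<otimes>\<^bsub>A\<^esub> y)"
  by (simp add: gsign_def mult_uminus_right)

lemma d_uminus: "x \<in> carrier A \<Longrightarrow> d (\<ominus>\<^bsub>A\<^esub> x) = \<ominus>\<^bsub>A\<^esub> d x"
  using d_add[of "\<ominus>\<^bsub>A\<^esub> x" x]
  by (intro M.minus_equality[symmetric]) (simp_all add: d_closed d_zero M.l_neg)

text \<open>The exponent \<open>k\<close> is decoupled from the degrees of \<open>x\<close> and
  \<open>y\<close>. For fixed \<open>k\<close> the expression is bilinear on the whole carrier, and
  \<open>d_bracket\<close> is a sum of such expressions over homogeneous components.\<close>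

definition formal_bracket where
  "formal_bracket k x y = x \<otimes>\<^bsub>A\<^esub> d y \<ominus>\<^bsub>A\<^esub> gsign A k (y \<otimes>\<^bsub>A\<^esub> d x)"

lemma formal_bracket_closed:
  "\<lbrakk>x \<in> carrier A; y \<in> carrier A\<rbrakk> \<Longrightarrow> formal_bracket k x y \<in> carrier A"
  by (simp add: formal_bracket_def gsign_closed mult_closed d_closed)

lemma formal_bracket_zero:
  assumes "x \<in> carrier A"
  shows "formal_bracket k \<zero>\<^bsub>A\<^esub> x = \<zero>\<^bsub>A\<^esub>" "formal_bracket k x \<zero>\<^bsub>A\<^esub> = \<zero>\<^bsub>A\<^esub>"
  using assms by (simp_all add: formal_bracket_def d_zero mult_zero_left mult_zero_right d_closed gsign_zero a_minus_def)

lemma formal_bracket_add_left: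
  assumes "x \<in> carrier A" "x' \<in> carrier A" "y \<in> carrier A"
  shows "formal_bracket k (x \<oplus>\<^bsub>A\<^esub> x') y = formal_bracket k x y \<oplus>\<^bsub>A\<^esub> formal_bracket k x' y"
  using assms by (simp add: formal_bracket_def d_add mult_distrib_left mult_distrib_right mult_closed
      d_closed gsign_add gsign_closed a_minus_def M.minus_add M.a_ac)

lemma formal_bracket_add_right:
  assumes "x \<in> carrier A" "y \<in> carrier A" "y' \<in> carrier A"
  shows "formal_bracket k x (y \<oplus>\<^bsub>A\<^esub> y') = formal_bracket k x y \<oplus>\<^bsub>A\<^esub> formal_bracket k x y'"
  using assms by (simp add: formal_bracket_def d_add mult_distrib_left mult_distrib_right mult_closed
      d_closed gsign_add gsign_closed a_minus_def M.minus_add M.a_ac)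

lemma formal_bracket_smult_left:
  assumes "r \<in> carrier R" "x \<in> carrier A" "y \<in> carrier A"
  shows "formal_bracket k (r \<odot>\<^bsub>A\<^esub> x) y = r \<odot>\<^bsub>A\<^esub> formal_bracket k x y"
  using assms by (simp add: formal_bracket_def d_smult smult_mult_left smult_mult_right mult_closed
      d_closed gsign_smult gsign_closed a_minus_def smult_r_distr smult_r_minus)

lemma formal_bracket_smult_right:
  assumes "r \<in> carrier R" "x \<in> carrier A" "y \<in> carrier A"
  shows "formal_bracket k x (r \<odot>\<^bsub>A\<^esub> y) = r \<odot>\<^bsub>A\<^esub> formal_bracket k x y"
  using assms by (simp add: formal_bracket_def d_smult smult_mult_left smult_mult_right mult_closed
      d_closed gsign_smult gsign_closed a_minus_def smult_r_distr smult_r_minus)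

text \<open>A zero component contributes a zero \<open>formal_bracket\<close>, so both index sets
  can be enlarged. Linearity needs this because the supports of the arguments being compared
  differ.\<close>

lemma d_bracket_eq_sum:
  assumes a: "a \<in> carrier A" and b: "b \<in> carrier A"
    and S: "finite S" "degree_support A gr a \<subseteq> S"
    and T: "finite T" "degree_support A gr b \<subseteq> T"
  shows "d_bracket A gr d a b = (\<Oplus>\<^bsub>A\<^esub>m \<in> S. \<Oplus>\<^bsub>A\<^esub>n \<in> T.
    formal_bracket ((m + 1) * (n + 1)) (homogeneous_component A gr a m) (homogeneous_component A gr b n))"
proof -
  let ?t = "\<lambda>m n. formal_bracket ((m + 1) * (n + 1))
    (homogeneous_component A gr a m) (homogeneous_component A gr b n)"
  have t: "?t m n \<in> carrier A" for m n
    using a b by (simp add: formal_bracket_closed homogeneous_component_closed)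
  have inner: "(\<Oplus>\<^bsub>A\<^esub>n \<in> degree_support A gr b. ?t m n) = (\<Oplus>\<^bsub>A\<^esub>n \<in> T. ?t m n)" for m
    using T t a by (intro M.add.finprod_mono_neutral_cong_left)
      (auto simp: homogeneous_component_outside_support formal_bracket_zero
        homogeneous_component_closed)
  have "(\<Oplus>\<^bsub>A\<^esub>m \<in> degree_support A gr a. \<Oplus>\<^bsub>A\<^esub>n \<in> T. ?t m n) = (\<Oplus>\<^bsub>A\<^esub>m \<in> S. \<Oplus>\<^bsub>A\<^esub>n \<in> T. ?t m n)"
    using S T(1) t b by (intro M.add.finprod_mono_neutral_cong_left)
      (auto simp: homogeneous_component_outside_support formal_bracket_zero
        homogeneous_component_closed Pi_def)
  then show ?thesis
    unfolding inner[symmetric] by (simp add: d_bracket_def formal_bracket_def)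
qed

lemma d_bracket_closed:
  assumes "a \<in> carrier A" "b \<in> carrier A"
  shows "d_bracket A gr d a b \<in> carrier A"
  unfolding d_bracket_eq_sum[OF assms finite_degree_support[OF assms(1)] order_refl
      finite_degree_support[OF assms(2)] order_refl]
  using assms by (simp add: Pi_def formal_bracket_closed homogeneous_component_closed)

lemma d_bracket_add_left:
  assumes "a \<in> carrier A" "a' \<in> carrier A" "b \<in> carrier A"
  shows "d_bracket A gr d (a \<oplus>\<^bsub>A\<^esub> a') b = d_bracket A gr d a b \<oplus>\<^bsub>A\<^esub> d_bracket A gr d a' b"
proof -
  \<comment> \<open>One index set contains all three supports, so the three brackets become sums
    over the same indices and can be compared term by term.\<close>
  let ?S = "degree_support A gr a \<union> degree_support A gr a' \<union> degree_support A gr (a \<oplus>\<^bsub>A\<^esub> a')"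
  let ?T = "degree_support A gr b"
  have fin: "finite ?S" "finite ?T" using assms by (auto intro: finite_degree_support)
  show ?thesis
    using assms fin
    by (simp add: d_bracket_eq_sum[where S = ?S and T = ?T] le_supI1 homogeneous_component_add
        formal_bracket_add_left homogeneous_component_closed formal_bracket_closed
        M.finsum_addf Pi_def)
qed

lemma d_bracket_add_right:
  assumes "a \<in> carrier A" "b \<in> carrier A" "b' \<in> carrier A"
  shows "d_bracket A gr d a (b \<oplus>\<^bsub>A\<^esub> b') = d_bracket A gr d a b \<oplus>\<^bsub>A\<^esub> d_bracket A gr d a b'"
proof -
  let ?S = "degree_support A gr a"
  let ?T = "degree_support A gr b \<union> degree_support A gr b' \<union> degree_support A gr (b \<oplus>\<^bsub>A\<^esub> b')"
  have fin: "finite ?S" "finite ?T" using assms by (auto intro: finite_degree_support)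
  show ?thesis
    using assms fin
    by (simp add: d_bracket_eq_sum[where S = ?S and T = ?T] le_supI1 homogeneous_component_add
        formal_bracket_add_right homogeneous_component_closed formal_bracket_closed
        M.finsum_addf Pi_def)
qed

lemma d_bracket_smult_left:
  assumes "r \<in> carrier R" "a \<in> carrier A" "b \<in> carrier A"
  shows "d_bracket A gr d (r \<odot>\<^bsub>A\<^esub> a) b = r \<odot>\<^bsub>A\<^esub> d_bracket A gr d a b"
proof -
  \<comment> \<open>The scalar may annihilate components of \<open>a\<close>, so the two supports
    need not coincide.\<close>
  let ?S = "degree_support A gr a \<union> degree_support A gr (r \<odot>\<^bsub>A\<^esub> a)"
  let ?T = "degree_support A gr b"
  have fin: "finite ?S" "finite ?T" using assms by (auto intro: finite_degree_support)
  show ?thesis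
    using assms fin
    by (simp add: d_bracket_eq_sum[where S = ?S and T = ?T] homogeneous_component_smult
        formal_bracket_smult_left homogeneous_component_closed formal_bracket_closed
        finsum_smult_ldistr Pi_def)
qed

lemma d_bracket_smult_right:
  assumes "r \<in> carrier R" "a \<in> carrier A" "b \<in> carrier A"
  shows "d_bracket A gr d a (r \<odot>\<^bsub>A\<^esub> b) = r \<odot>\<^bsub>A\<^esub> d_bracket A gr d a b"
proof -
  let ?S = "degree_support A gr a"
  let ?T = "degree_support A gr b \<union> degree_support A gr (r \<odot>\<^bsub>A\<^esub> b)"
  have fin: "finite ?S" "finite ?T" using assms by (auto intro: finite_degree_support)
  show ?thesis
    using assms fin
    by (simp add: d_bracket_eq_sum[where S = ?S and T = ?T] homogeneous_component_smult
        formal_bracket_smult_right homogeneous_component_closed formal_bracket_closed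
        finsum_smult_ldistr Pi_def)
qed

section \<open>Degree, antisymmetry, derivation property and Jacobi identity\<close>

lemma d_bracket_degree:
  assumes "a \<in> gr m" "b \<in> gr n"
  shows "d_bracket A gr d a b \<in> gr (m + n + 1)"
proof -
  have "a \<otimes>\<^bsub>A\<^esub> d b \<in> gr (m + n + 1)" "b \<otimes>\<^bsub>A\<^esub> d a \<in> gr (m + n + 1)"
    using gr_mult[OF assms(1) d_degree[OF assms(2)]] gr_mult[OF assms(2) d_degree[OF assms(1)]]
    by (simp_all add: algebra_simps)
  then show ?thesis
    unfolding d_bracket_homogeneous[OF assms] by (intro gr_minus gsign_gr)
qed

text \<open>Swapping the arguments exchanges the two terms; the sign is symmetric in
  \<open>m\<close> and \<open>n\<close> and squares to 1.\<close>

lemma d_bracket_antisymmetric: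
  assumes "a \<in> gr m" "b \<in> gr n"
  shows "d_bracket A gr d a b = \<ominus>\<^bsub>A\<^esub> gsign A ((m + 1) * (n + 1)) (d_bracket A gr d b a)"
proof -
  have "a \<in> carrier A" "b \<in> carrier A" using assms gr_carrier by auto
  then show ?thesis
    unfolding d_bracket_homogeneous[OF assms] d_bracket_homogeneous[OF assms(2,1)]
    by (simp add: gsign_def a_minus_def M.minus_add d_closed mult_closed M.a_comm)
qed

text \<open>Both terms containing \<open>d \<circ> d\<close> vanish, and what remains of \<open>d [a, b]\<close> does not depend on
  the sign \<open>(-1)\<^sup>m\<close> of the Leibniz rule.\<close>

lemma d_d_bracket:
  assumes "a \<in> gr m" "b \<in> gr n"
  shows "d (d_bracket A gr d a b) =
    d a \<otimes>\<^bsub>A\<^esub> d b \<ominus>\<^bsub>A\<^esub> gsign A ((m + 1) * (n + 1)) (d b \<otimes>\<^bsub>A\<^esub> d a)"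
proof -
  have c: "a \<in> carrier A" "b \<in> carrier A" using assms gr_carrier by auto
  have "d (a \<otimes>\<^bsub>A\<^esub> d b) = d a \<otimes>\<^bsub>A\<^esub> d b" "d (b \<otimes>\<^bsub>A\<^esub> d a) = d b \<otimes>\<^bsub>A\<^esub> d a"
    using c d_derivation[OF assms(1) d_degree[OF assms(2)]]
      d_derivation[OF assms(2) d_degree[OF assms(1)]]
    by (simp_all add: d_square mult_zero_left mult_zero_right gsign_zero d_closed mult_closed)
  then show ?thesis
    using c unfolding d_bracket_homogeneous[OF assms]
    by (simp add: gsign_def a_minus_def d_add d_uminus d_closed mult_closed)
qed

text \<open>Since \<open>d\<close> squares to zero, each bracket on the right keeps one term:
  [da, b] = da db and [a, db] = -(-1)^((m+1)(n+2)) db da. The factor (-1)^(m+1) turns the latter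
  exponent into (m+1)(n+3), which has the parity of (m+1)(n+1), as \<open>d_d_bracket\<close>
  requires.\<close>

lemma d_bracket_derivation:
  assumes "a \<in> gr m" "b \<in> gr n"
  shows "d (d_bracket A gr d a b) =
    d_bracket A gr d (d a) b \<oplus>\<^bsub>A\<^esub> gsign A (m + 1) (d_bracket A gr d a (d b))"
proof -
  have "a \<in> carrier A" "b \<in> carrier A" using assms gr_carrier by auto
  then show ?thesis
    unfolding d_d_bracket[OF assms] d_bracket_homogeneous[OF d_degree[OF assms(1)] assms(2)]
      d_bracket_homogeneous[OF assms(1) d_degree[OF assms(2)]]
    by (auto simp: gsign_def a_minus_def d_square mult_zero_left mult_zero_right d_closed mult_closed)
qed

text \<open>Each double bracket expands into four signed monomials. Those on the left are
  \<open>t1\<close> to \<open>t4\<close>; on the right \<open>t5\<close> and \<open>t6\<close> each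
  occur twice, with opposite signs.\<close>

lemma d_bracket_jacobi:
  assumes a: "a \<in> gr m" and b: "b \<in> gr n" and c: "c \<in> gr p"
  shows "d_bracket A gr d a (d_bracket A gr d b c) =
    d_bracket A gr d (d_bracket A gr d a b) c \<oplus>\<^bsub>A\<^esub>
    gsign A ((m + 1) * (n + 1)) (d_bracket A gr d b (d_bracket A gr d a c))"
proof -
  have car: "a \<in> carrier A" "b \<in> carrier A" "c \<in> carrier A" using assms gr_carrier by auto
  note expand = a_minus_def gsign_closed d_closed mult_closed mult_distrib_left mult_distrib_right
    mult_gsign_left mult_gsign_right mult_uminus_left mult_uminus_right mult_assoc
  let ?ab = "(m + 1) * (n + 1)" and ?bc = "(n + 1) * (p + 1)" and ?ac = "(m + 1) * (p + 1)"
  define t1 t2 t3 t4 t5 t6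
    where t: "t1 = a \<otimes>\<^bsub>A\<^esub> (d b \<otimes>\<^bsub>A\<^esub> d c)" "t2 = a \<otimes>\<^bsub>A\<^esub> (d c \<otimes>\<^bsub>A\<^esub> d b)"
      "t3 = b \<otimes>\<^bsub>A\<^esub> (d c \<otimes>\<^bsub>A\<^esub> d a)" "t4 = c \<otimes>\<^bsub>A\<^esub> (d b \<otimes>\<^bsub>A\<^esub> d a)"
      "t5 = b \<otimes>\<^bsub>A\<^esub> (d a \<otimes>\<^bsub>A\<^esub> d c)" "t6 = c \<otimes>\<^bsub>A\<^esub> (d a \<otimes>\<^bsub>A\<^esub> d b)"
  have t_closed: "t1 \<in> carrier A" "t2 \<in> carrier A" "t3 \<in> carrier A" "t4 \<in> carrier A"
    "t5 \<in> carrier A" "t6 \<in> carrier A"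
    using car by (simp_all add: t mult_closed d_closed)
  \<comment> \<open>In one half of each outer bracket the inner bracket is differentiated, and
    \<open>d_d_bracket\<close> leaves two monomials.\<close>
  have outer:
    "a \<otimes>\<^bsub>A\<^esub> d (d_bracket A gr d b c) = t1 \<ominus>\<^bsub>A\<^esub> gsign A ?bc t2"
    "c \<otimes>\<^bsub>A\<^esub> d (d_bracket A gr d a b) = t6 \<ominus>\<^bsub>A\<^esub> gsign A ?ab t4"
    "b \<otimes>\<^bsub>A\<^esub> d (d_bracket A gr d a c) = t5 \<ominus>\<^bsub>A\<^esub> gsign A ?ac t3"
    unfolding d_d_bracket[OF a b] d_d_bracket[OF b c] d_d_bracket[OF a c] t
    using car by (simp_all add: expand)
  \<comment> \<open>In the other half the inner bracket is a left factor; it is expanded by its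
    formula and reassociated to the right.\<close>
  have inner:
    "d_bracket A gr d b c \<otimes>\<^bsub>A\<^esub> d a = t3 \<ominus>\<^bsub>A\<^esub> gsign A ?bc t4"
    "d_bracket A gr d a b \<otimes>\<^bsub>A\<^esub> d c = t1 \<ominus>\<^bsub>A\<^esub> gsign A ?ab t5"
    "d_bracket A gr d a c \<otimes>\<^bsub>A\<^esub> d b = t2 \<ominus>\<^bsub>A\<^esub> gsign A ?ac t6"
    unfolding d_bracket_homogeneous[OF a b] d_bracket_homogeneous[OF b c]
      d_bracket_homogeneous[OF a c] t
    using car by (simp_all add: expand)
  \<comment> \<open>This removes the opposite pairs of \<open>t5\<close> and \<open>t6\<close> from
    a sum in which the two surviving monomials stand between them.\<close>
  have cancel: "t5 \<oplus>\<^bsub>A\<^esub> (t6 \<oplus>\<^bsub>A\<^esub> (x \<oplus>\<^bsub>A\<^esub> (y \<oplus>\<^bsub>A\<^esub> (\<ominus>\<^bsub>A\<^esub> t5 \<oplus>\<^bsub>A\<^esub> \<ominus>\<^bsub>A\<^esub> t6)))) = x \<oplus>\<^bsub>A\<^esub> y"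
    if "x \<in> carrier A" "y \<in> carrier A" for x y
  proof -
    have "t5 \<oplus>\<^bsub>A\<^esub> (t6 \<oplus>\<^bsub>A\<^esub> (x \<oplus>\<^bsub>A\<^esub> (y \<oplus>\<^bsub>A\<^esub> (\<ominus>\<^bsub>A\<^esub> t5 \<oplus>\<^bsub>A\<^esub> \<ominus>\<^bsub>A\<^esub> t6)))) =
        (t5 \<oplus>\<^bsub>A\<^esub> \<ominus>\<^bsub>A\<^esub> t5) \<oplus>\<^bsub>A\<^esub> ((t6 \<oplus>\<^bsub>A\<^esub> \<ominus>\<^bsub>A\<^esub> t6) \<oplus>\<^bsub>A\<^esub> (x \<oplus>\<^bsub>A\<^esub> y))"
      using that t_closed by (simp add: M.a_ac)
    then show ?thesis using that t_closed by (simp add: M.r_neg)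
  qed
  \<comment> \<open>The inner brackets are homogeneous by \<open>d_bracket_degree\<close>, so the
    formula applies to the outer brackets too. All signs depend only on the parities of
    \<open>m\<close>, \<open>n\<close> and \<open>p\<close>, which leaves eight identities in an
    abelian group.\<close>
  show ?thesis
    unfolding d_bracket_homogeneous[OF a d_bracket_degree[OF b c]]
      d_bracket_homogeneous[OF d_bracket_degree[OF a b] c]
      d_bracket_homogeneous[OF b d_bracket_degree[OF a c]] outer inner
    using t_closed
    by (cases "even m"; cases "even n"; cases "even p")
      (simp_all add: gsign_def a_minus_def M.minus_add M.a_ac cancel)
qed

lemma lie_bracket_degree_1_d_bracket: "lie_bracket_degree_1 R A gr (d_bracket A gr d)"
  by unfold_locales
    (fact d_bracket_closed d_bracket_add_left d_bracket_add_right d_bracket_smult_left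
      d_bracket_smult_right d_bracket_degree d_bracket_antisymmetric d_bracket_jacobi)+

end

section \<open>Failure of the Poisson relation\<close>

text \<open>
  Over the two-element field \<open>F\<^sub>2\<close>, the dual numbers \<open>u + v e\<close> with \<open>e\<^sup>2 = 0\<close>, \<open>e\<close> of degree
  \<open>-1\<close> and \<open>d e = 1\<close>, encoded as the natural number \<open>u + 2 v\<close>. There
  \<open>[e, 1 1] = 1\<close>, while \<open>[e, 1] 1 + 1 [e, 1] = 1 + 1 = 0\<close>.
\<close>

definition F2 :: "nat ring" where
  "F2 = \<lparr>carrier = {0, 1}, mult = (*), one = 1, zero = 0, add = (\<lambda>x y. (x + y) mod 2)\<rparr>"

text \<open>The coefficients of 1 and e are \<open>x mod 2\<close> and \<open>x div 2\<close>; the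
  product omits the term \<open>x div 2 * (y div 2)\<close>, which belongs to e^2. The only scalars
  are 0 and 1, so multiplication of naturals serves as \<open>smult\<close>.\<close>

definition dual_numbers_F2 :: "(nat, nat) module" where
  "dual_numbers_F2 =
    \<lparr>carrier = {0, 1, 2, 3},
     mult = (\<lambda>x y. (x mod 2) * (y mod 2) + 2 * ((x mod 2 * (y div 2) + x div 2 * (y mod 2)) mod 2)),
     one = 1, zero = 0,
     add = (\<lambda>x y. (x + y) mod 2 + 2 * ((x div 2 + y div 2) mod 2)),
     smult = (*)\<rparr>"

definition dual_grading :: "int \<Rightarrow> nat set" where
  "dual_grading n = (if n = 0 then {0, 1} else if n = -1 then {0, 2} else {0})"

lemma cring_F2: "cring F2"
  by (intro cringI abelian_groupI comm_monoidI) (auto simp: F2_def)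

lemma module_dual_numbers_F2: "module F2 dual_numbers_F2"
  by (intro moduleI cring_F2 abelian_groupI) (auto simp: F2_def dual_numbers_F2_def)

interpretation dual: module F2 dual_numbers_F2
  by (rule module_dual_numbers_F2)

text \<open>In characteristic 2 we have x + x = 0, so every sign in the axioms disappears.\<close>

lemma uminus_dual_numbers_F2:
  "x \<in> carrier dual_numbers_F2 \<Longrightarrow> \<ominus>\<^bsub>dual_numbers_F2\<^esub> x = x"
  by (rule dual.M.minus_equality) (auto simp: dual_numbers_F2_def)

lemma gsign_dual_numbers_F2:
  "x \<in> carrier dual_numbers_F2 \<Longrightarrow> gsign dual_numbers_F2 k x = x"
  by (simp add: gsign_def uminus_dual_numbers_F2)

lemma dual_grading_carrier: "dual_grading n \<subseteq> carrier dual_numbers_F2"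
  by (auto simp: dual_grading_def dual_numbers_F2_def)

lemma submodule_dual_grading: "submodule (dual_grading n) F2 dual_numbers_F2"
proof (rule dual.submoduleI)
  show "\<ominus>\<^bsub>dual_numbers_F2\<^esub> x \<in> dual_grading n" if "x \<in> dual_grading n" for x
    using that dual_grading_carrier uminus_dual_numbers_F2[of x] by (metis subsetD)
qed (auto simp: dual_grading_def dual_numbers_F2_def F2_def split: if_splits)

text \<open>The equivalence with an explicit function yields existence and uniqueness in the direct
  sum axiom at once.\<close>

lemma homogeneous_decomposition_dual_iff:
  assumes x: "x \<in> carrier dual_numbers_F2"
  shows "homogeneous_decomposition dual_numbers_F2 dual_grading x f \<longleftrightarrow>
    f = (\<lambda>n. if n = 0 then x mod 2 else if n = -1 then 2 * (x div 2) else 0)"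
proof -
  \<comment> \<open>The sum runs over the exact support of \<open>f\<close>; padding it with zeros
    to {0, -1} gives a two-term expression for every admissible \<open>f\<close>.\<close>
  have sum: "(\<Oplus>\<^bsub>dual_numbers_F2\<^esub>n \<in> {n. f n \<noteq> \<zero>\<^bsub>dual_numbers_F2\<^esub>}. f n)
      = f 0 \<oplus>\<^bsub>dual_numbers_F2\<^esub> f (- 1)"
    and supp: "{n. f n \<noteq> \<zero>\<^bsub>dual_numbers_F2\<^esub>} \<subseteq> {0, -1}"
    if f: "\<And>n. f n \<in> dual_grading n" for f
  proof -
    have fc: "f n \<in> carrier dual_numbers_F2" for n using f dual_grading_carrier by blast
    have z: "f n = \<zero>\<^bsub>dual_numbers_F2\<^esub>" if "n \<noteq> 0" "n \<noteq> -1" for n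
      using f[of n] that by (simp add: dual_grading_def dual_numbers_F2_def)
    then show supp: "{n. f n \<noteq> \<zero>\<^bsub>dual_numbers_F2\<^esub>} \<subseteq> {0, -1}" by blast
    have "(\<Oplus>\<^bsub>dual_numbers_F2\<^esub>n \<in> {n. f n \<noteq> \<zero>\<^bsub>dual_numbers_F2\<^esub>}. f n)
        = (\<Oplus>\<^bsub>dual_numbers_F2\<^esub>n \<in> {0, -1}. f n)"
      using supp fc by (intro dual.M.add.finprod_mono_neutral_cong_left) auto
    also have "\<dots> = f 0 \<oplus>\<^bsub>dual_numbers_F2\<^esub> f (- 1)" using fc by simp
    finally show "(\<Oplus>\<^bsub>dual_numbers_F2\<^esub>n \<in> {n. f n \<noteq> \<zero>\<^bsub>dual_numbers_F2\<^esub>}. f n)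
      = f 0 \<oplus>\<^bsub>dual_numbers_F2\<^esub> f (- 1)" .
  qed
  let ?f = "\<lambda>n :: int. if n = 0 then x mod 2 else if n = -1 then 2 * (x div 2) else 0"
  show ?thesis
  proof
    assume "homogeneous_decomposition dual_numbers_F2 dual_grading x f"
    then have f: "\<And>n. f n \<in> dual_grading n" and
      x': "x = (\<Oplus>\<^bsub>dual_numbers_F2\<^esub>n \<in> {n. f n \<noteq> \<zero>\<^bsub>dual_numbers_F2\<^esub>}. f n)"
      by (auto simp: homogeneous_decomposition_def)
    \<comment> \<open>With \<open>f 0\<close> in {0, 1} and \<open>f (-1)\<close> in {0, 2}, the sum
      determines both values as the two binary digits of \<open>x\<close>.\<close>
    have "x = f 0 \<oplus>\<^bsub>dual_numbers_F2\<^esub> f (- 1)" using x' sum[OF f] by simp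
    moreover have "f 0 \<in> {0, 1}" "f (-1) \<in> {0, 2}"
      using f[of 0] f[of "-1"] by (simp_all add: dual_grading_def)
    moreover have "f n = 0" if "n \<noteq> 0" "n \<noteq> -1" for n
      using f[of n] that by (simp add: dual_grading_def)
    ultimately show "f = ?f" by (intro ext) (auto simp: dual_numbers_F2_def)
  next
    assume f: "f = ?f"
    have gr: "f n \<in> dual_grading n" for n
      unfolding f using x by (auto simp: dual_numbers_F2_def dual_grading_def)
    have "x = f 0 \<oplus>\<^bsub>dual_numbers_F2\<^esub> f (- 1)"
      unfolding f using x by (auto simp: dual_numbers_F2_def)
    then show "homogeneous_decomposition dual_numbers_F2 dual_grading x f"
      unfolding homogeneous_decomposition_def sum[OF gr]
      using gr finite_subset[OF supp[OF gr]] by simp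
  qed
qed

text \<open>The map \<open>x div 2\<close> is d/de: it sends u + v e to v. Apart from the module,
  submodule and direct sum axioms, settled above, only finite checks on the four elements
  remain.\<close>

lemma dg_assoc_algebra_dual_numbers_F2:
  "dg_assoc_algebra F2 dual_numbers_F2 dual_grading (\<lambda>x. x div 2)"
proof (intro dg_assoc_algebra.intro graded_assoc_algebra.intro graded_assoc_algebra_axioms.intro
    dg_assoc_algebra_axioms.intro)
  fix x y m n
  assume x: "x \<in> dual_grading m" and y: "y \<in> dual_grading n"
  show "x \<otimes>\<^bsub>dual_numbers_F2\<^esub> y \<in> dual_grading (m + n)"
    using x y by (auto simp: dual_grading_def dual_numbers_F2_def split: if_splits)
  \<comment> \<open>Carrier membership is what allows the Leibniz sign to be dropped.\<close>
  have "x \<in> carrier dual_numbers_F2" "y div 2 \<in> carrier dual_numbers_F2"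
    using x y by (auto simp: dual_grading_def dual_numbers_F2_def split: if_splits)
  then have c: "x \<otimes>\<^bsub>dual_numbers_F2\<^esub> (y div 2) \<in> carrier dual_numbers_F2"
    by (auto simp: dual_numbers_F2_def)
  show "(x \<otimes>\<^bsub>dual_numbers_F2\<^esub> y) div 2 =
      (x div 2) \<otimes>\<^bsub>dual_numbers_F2\<^esub> y \<oplus>\<^bsub>dual_numbers_F2\<^esub>
      gsign dual_numbers_F2 m (x \<otimes>\<^bsub>dual_numbers_F2\<^esub> (y div 2))"
    unfolding gsign_dual_numbers_F2[OF c]
    using x y by (auto simp: dual_grading_def dual_numbers_F2_def split: if_splits)
next
  fix x n
  assume "x \<in> dual_grading n"
  then show "x div 2 \<in> dual_grading (n + 1)"
    by (auto simp: dual_grading_def split: if_splits)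
next
  fix x y z
  assume "x \<in> carrier dual_numbers_F2" "y \<in> carrier dual_numbers_F2" "z \<in> carrier dual_numbers_F2"
  then show "x \<otimes>\<^bsub>dual_numbers_F2\<^esub> y \<otimes>\<^bsub>dual_numbers_F2\<^esub> z =
      x \<otimes>\<^bsub>dual_numbers_F2\<^esub> (y \<otimes>\<^bsub>dual_numbers_F2\<^esub> z)"
    and "(x \<oplus>\<^bsub>dual_numbers_F2\<^esub> y) \<otimes>\<^bsub>dual_numbers_F2\<^esub> z =
      x \<otimes>\<^bsub>dual_numbers_F2\<^esub> z \<oplus>\<^bsub>dual_numbers_F2\<^esub> y \<otimes>\<^bsub>dual_numbers_F2\<^esub> z"
    and "x \<otimes>\<^bsub>dual_numbers_F2\<^esub> (y \<oplus>\<^bsub>dual_numbers_F2\<^esub> z) =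
      x \<otimes>\<^bsub>dual_numbers_F2\<^esub> y \<oplus>\<^bsub>dual_numbers_F2\<^esub> x \<otimes>\<^bsub>dual_numbers_F2\<^esub> z"
    by (auto simp: dual_numbers_F2_def)
next
  fix x y
  assume "x \<in> carrier dual_numbers_F2" "y \<in> carrier dual_numbers_F2"
  then show "x \<otimes>\<^bsub>dual_numbers_F2\<^esub> y \<in> carrier dual_numbers_F2"
    and "(x \<oplus>\<^bsub>dual_numbers_F2\<^esub> y) div 2 = x div 2 \<oplus>\<^bsub>dual_numbers_F2\<^esub> y div 2"
    by (auto simp: dual_numbers_F2_def)
qed (simp_all add: module_dual_numbers_F2 homogeneous_decomposition_dual_iff submodule_dual_grading,
     auto simp: F2_def dual_numbers_F2_def)

text \<open>This is [e, 1] = e d(1) - 1 d(e) = 0 - 1 = 1 in characteristic 2; the exponent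
  (-1+1)(0+1) is 0.\<close>

lemma d_bracket_dual_numbers_F2:
  "d_bracket dual_numbers_F2 dual_grading (\<lambda>x. x div 2) 2 1 = 1"
proof -
  interpret dg_assoc_algebra F2 dual_numbers_F2 dual_grading "\<lambda>x. x div 2"
    by (rule dg_assoc_algebra_dual_numbers_F2)
  have "2 \<in> dual_grading (-1)" "1 \<in> dual_grading 0" by (simp_all add: dual_grading_def)
  moreover have "\<ominus>\<^bsub>dual_numbers_F2\<^esub> 1 = 1"
    by (rule uminus_dual_numbers_F2) (simp add: dual_numbers_F2_def)
  moreover have "2 \<otimes>\<^bsub>dual_numbers_F2\<^esub> 0 = 0" "1 \<otimes>\<^bsub>dual_numbers_F2\<^esub> 1 = 1"
      "0 \<oplus>\<^bsub>dual_numbers_F2\<^esub> 1 = 1"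
    by (simp_all add: dual_numbers_F2_def)
  ultimately show ?thesis
    by (simp add: d_bracket_homogeneous a_minus_def gsign_def)
qed

theorem mainTheorem9:
  shows
    "(\<forall>(R :: ('a, 'r) ring_scheme) (A :: ('a, 'b, 'm) module_scheme) gr d.
        dg_assoc_algebra R A gr d \<longrightarrow>
          lie_bracket_degree_1 R A gr (d_bracket A gr d) \<and>
          (\<forall>m n. \<forall>a \<in> gr m. \<forall>b \<in> gr n.
            d (d_bracket A gr d a b) =
              d_bracket A gr d (d a) b \<oplus>\<^bsub>A\<^esub> gsign A (m + 1) (d_bracket A gr d a (d b))))
     \<and>
     (\<exists>(R :: nat ring) (A :: (nat, nat) module) gr d.
        dg_assoc_algebra R A gr d \<and>
        \<not> (\<forall>m n p. \<forall>a \<in> gr m. \<forall>b \<in> gr n. \<forall>c \<in> gr p.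
            d_bracket A gr d a (b \<otimes>\<^bsub>A\<^esub> c) =
              d_bracket A gr d a b \<otimes>\<^bsub>A\<^esub> c
              \<oplus>\<^bsub>A\<^esub> gsign A ((m + 1) * n) (b \<otimes>\<^bsub>A\<^esub> d_bracket A gr d a c)))"
    (is "?lie \<and> ?not_poisson")
proof
  show ?lie
    by (intro allI impI conjI ballI dg_assoc_algebra.lie_bracket_degree_1_d_bracket
        dg_assoc_algebra.d_bracket_derivation)
next
  let ?A = dual_numbers_F2 and ?gr = dual_grading and ?d = "\<lambda>x :: nat. x div 2"
  \<comment> \<open>The witnesses are \<open>a = 2\<close>, which encodes e, and
    \<open>b = c = 1\<close>.\<close>
  have gr: "2 \<in> ?gr (-1)" "1 \<in> ?gr 0" by (simp_all add: dual_grading_def)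
  have "1 \<otimes>\<^bsub>?A\<^esub> 1 = 1" "1 \<oplus>\<^bsub>?A\<^esub> 1 = 0" by (simp_all add: dual_numbers_F2_def)
  \<comment> \<open>The left side is 1 and the right side 1 + 1 = 0. The exponent keeps the degrees
    -1 and 0 visible so that it matches the instance of the assumed relation.\<close>
  then have neq: "d_bracket ?A ?gr ?d 2 (1 \<otimes>\<^bsub>?A\<^esub> 1) \<noteq>
      d_bracket ?A ?gr ?d 2 1 \<otimes>\<^bsub>?A\<^esub> 1
      \<oplus>\<^bsub>?A\<^esub> gsign ?A ((-1 + 1) * 0) (1 \<otimes>\<^bsub>?A\<^esub> d_bracket ?A ?gr ?d 2 1)"
    by (simp add: d_bracket_dual_numbers_F2 gsign_def del: One_nat_def)
  show ?not_poisson
  proof (intro exI conjI notI)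
    show "dg_assoc_algebra F2 ?A ?gr ?d" by (rule dg_assoc_algebra_dual_numbers_F2)
    assume "\<forall>m n p. \<forall>a \<in> ?gr m. \<forall>b \<in> ?gr n. \<forall>c \<in> ?gr p.
      d_bracket ?A ?gr ?d a (b \<otimes>\<^bsub>?A\<^esub> c) =
        d_bracket ?A ?gr ?d a b \<otimes>\<^bsub>?A\<^esub> c
        \<oplus>\<^bsub>?A\<^esub> gsign ?A ((m + 1) * n) (b \<otimes>\<^bsub>?A\<^esub> d_bracket ?A ?gr ?d a c)"
    from this[rule_format, OF gr(1) gr(2) gr(2)] neq show False by contradiction
  qed
qed

end
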